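(* For an index set $Q$, let $\mathbf{H}_Q$ be the collection of all subsets of $\mathbb{N}$ of the form $H_Q^S(A_q)$, where $S$ ranges over all semigroups and $(A_q)_{q\in Q}$ ranges over all $Q$-indexed families of subsets of $S$. Then $$\mathbf{H}_Q=\begin{cases}\{\{1\},\mathbb{N}\}, & Q=\varnothing,\\ \{\mathbb{N}\}, & |Q|=1,\\ \{X\subseteq\mathbb{N}: 1\in X\}, & |Q|\ge 2.\end{cases}$$
   Context: $\mathbb{N}=\{1,2,3,\dots\}$. For a subset $B$ of a (multiplicative) semigroup $S$ and $h\in\mathbb{N}$, the $h$-fold product set is $B^h=\{b_1\cdots b_h: b_1,\dots,b_h\in B\}$. For a family $(A_q)_{q\in Q}$ of subsets of $S$ indexed by a set $Q$ (possibly empty or infinite), put $A=\bigcap_{q\in Q}A_q$; an intersection of subsets of $S$ over the empty index set is interpreted as all of $S$. The product intersection set is $$H_Q^{S}(A_q)=\Bigl\{h\in\mathbb{N}: A^h=\bigcap_{q\in Q}A_q^h\Bigr\}.$$ *)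

theory Defs
  imports Main
begin

locale semigroup_on =
  fixes S :: "'s set" and mult :: "'s \<Rightarrow> 's \<Rightarrow> 's" (infixl "\<cdot>" 70)
  assumes nonempty: "S \<noteq> {}"
    and closed: "\<lbrakk>x \<in> S; y \<in> S\<rbrakk> \<Longrightarrow> x \<cdot> y \<in> S"
    and assoc: "\<lbrakk>x \<in> S; y \<in> S; z \<in> S\<rbrakk> \<Longrightarrow> (x \<cdot> y) \<cdot> z = x \<cdot> (y \<cdot> z)"

(* The h-fold product set: the h factors are b and the members of bs, so that no identity
   element is needed. For h = 0 this is the empty set; only h >= 1 is used below. *)
definition product_set :: "('s \<Rightarrow> 's \<Rightarrow> 's) \<Rightarrow> 's set \<Rightarrow> nat \<Rightarrow> 's set" where
  "product_set mult B h =
     {foldl mult b bs | b bs. b \<in> B \<and> set bs \<subseteq> B \<and> Suc (length bs) = h}"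

(* Intersection of subsets of S; over the empty index set it is S rather than UNIV. *)
definition Inter_within :: "'s set \<Rightarrow> 'q set \<Rightarrow> ('q \<Rightarrow> 's set) \<Rightarrow> 's set" where
  "Inter_within S Q A = {x \<in> S. \<forall>q\<in>Q. x \<in> A q}"

definition product_intersection_set ::
    "'s set \<Rightarrow> ('s \<Rightarrow> 's \<Rightarrow> 's) \<Rightarrow> 'q set \<Rightarrow> ('q \<Rightarrow> 's set) \<Rightarrow> nat set" where
  "product_intersection_set S mult Q A =
     {h. 1 \<le> h \<and> product_set mult (Inter_within S Q A) h
                    = Inter_within S Q (\<lambda>q. product_set mult (A q) h)}"

(* S ranges over all semigroups whose carrier is a subset of the type 's. HOL cannot quantify
   over types inside a definition, so the ambient type is a parameter. Each semigroup, finite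
   or of any infinite cardinality, occurs up to isomorphism for some infinite type 's. *)
definition product_intersection_sets :: "'s itself \<Rightarrow> 'q set \<Rightarrow> nat set set" where
  "product_intersection_sets _ Q =
     {product_intersection_set S mult Q A | (S :: 's set) mult A.
        semigroup_on S mult \<and> (\<forall>q\<in>Q. A q \<subseteq> S)}"

end

theory Submission
  imports Defs "HOL-Library.Countable"
begin

text \<open>
  For an empty or a one-element index set the description is forced. Over the empty set,
  \<open>h\<close> belongs to the product intersection set iff \<open>S\<^sup>h = S\<close>, and if this holds for a single
  \<open>h \<ge> 2\<close>, then \<open>S = S\<^sup>h \<subseteq> S\<^sup>2\<close>, so that \<open>S\<close> equals all of its powers. Over a one-element
  set both sides of the defining equation are the same set.

  For at least two indices, the only restriction is that \<open>1\<close> belongs to the set: \<open>A\<^sup>1 = A\<close>.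
  To realize any \<open>X\<close> containing \<open>1\<close>, take generators \<open>a\<^sub>n\<close> and \<open>b\<^sub>n\<close> for every \<open>n \<ge> 1\<close>,
  subject to \<open>a\<^sub>n\<^sup>n = b\<^sub>n\<^sup>n\<close>, and declare a product to be an absorbing element \<open>0\<close> if it
  mixes different generators or has more than \<open>n\<close> factors. Let one set of the family consist
  of \<open>0\<close> and the \<open>b\<^sub>n\<close> with \<open>n \<notin> X\<close>, and let all the others consist of \<open>0\<close> and the \<open>a\<^sub>n\<close>
  with \<open>n \<notin> X\<close>. Their intersection is \<open>{0}\<close>, with all powers \<open>{0}\<close>, whereas the \<open>h\<close>-th
  powers of the two sets have a common nonzero element, \<open>a\<^sub>h\<^sup>h = b\<^sub>h\<^sup>h\<close>, exactly when
  \<open>h \<notin> X\<close>. This semigroup is countable, so a copy of it lives in every infinite type. The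
  computation of the powers is \<open>product_set_generators\<close>; the passage to another type is
  \<open>product_intersection_set_image\<close>.
\<close>

section \<open>Product sets\<close>

lemma product_set_1 [simp]: "product_set mult B (Suc 0) = B"
  by (auto simp: product_set_def)

lemma product_set_Suc:
  assumes "1 \<le> h"
  shows "product_set mult B (Suc h) = {mult x y | x y. x \<in> product_set mult B h \<and> y \<in> B}"
    (is "?L = ?R")
proof
  show "?L \<subseteq> ?R"
  proof
    fix z assume "z \<in> ?L"
    then obtain b bs where b: "b \<in> B" "set bs \<subseteq> B" "length bs = h" "z = foldl mult b bs"
      by (auto simp: product_set_def)
    then obtain cs c where c: "bs = cs @ [c]"
      using assms by (cases bs rule: rev_cases) auto
    have "foldl mult b cs \<in> product_set mult B h"
      unfolding product_set_def using b c by auto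
    then show "z \<in> ?R" using b c by auto
  qed
  show "?R \<subseteq> ?L"
  proof
    fix z assume "z \<in> ?R"
    then obtain b bs c where b: "b \<in> B" "set bs \<subseteq> B" "Suc (length bs) = h" "c \<in> B"
      "z = mult (foldl mult b bs) c"
      by (auto simp: product_set_def)
    then have "z = foldl mult b (bs @ [c])" "set (bs @ [c]) \<subseteq> B" "Suc (length (bs @ [c])) = Suc h"
      by auto
    then show "z \<in> ?L" unfolding product_set_def using b(1) by blast
  qed
qed

lemma (in semigroup_on) product_set_subset:
  assumes "1 \<le> h" "B \<subseteq> S"
  shows "product_set mult B h \<subseteq> S"
  using assms(1)
proof (induction h rule: dec_induct)
  case base
  then show ?case using assms(2) by simp
next
  case (step n)
  then show ?case using assms(2) by (auto simp: product_set_Suc intro!: closed)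
qed

lemma Inter_within_singleton: "B q \<subseteq> S \<Longrightarrow> Inter_within S {q} B = B q"
  by (auto simp: Inter_within_def)

lemma product_intersection_sets_basic:
  assumes "X \<in> product_intersection_sets TYPE('s) Q"
  shows "X \<subseteq> {1..}" "1 \<in> X"
  using assms by (auto simp: product_intersection_sets_def product_intersection_set_def)

section \<open>Restrictions for small index sets\<close>

lemma (in semigroup_on) product_intersection_set_empty:
  "product_intersection_set S mult {} A \<in> {{1}, {1..}}"
proof (cases "\<exists>h\<ge>2. product_set mult S h = S")
  case True
  then obtain h where h: "h \<ge> 2" "product_set mult S h = S" by blast
  obtain k where k: "h = Suc k" "1 \<le> k" using h(1) by (cases h) auto
  have "S \<subseteq> {mult x y | x y. x \<in> S \<and> y \<in> S}"
    using h(2) product_set_subset[OF k(2) order_refl] unfolding k(1) product_set_Suc[OF k(2)]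
    by blast
  then have SS: "{mult x y | x y. x \<in> S \<and> y \<in> S} = S"
    using closed by blast
  have "product_set mult S n = S" if "1 \<le> n" for n
    using that by (induction n rule: dec_induct) (simp_all add: product_set_Suc SS)
  then show ?thesis by (auto simp: product_intersection_set_def Inter_within_def)
next
  case False
  then have "product_set mult S h = S \<longleftrightarrow> h = 1" if "1 \<le> h" for h
    using that by (metis One_nat_def Suc_1 Suc_leI le_neq_implies_less product_set_1)
  then show ?thesis by (auto simp: product_intersection_set_def Inter_within_def)
qed

lemma (in semigroup_on) product_intersection_set_singleton:
  assumes "A q \<subseteq> S"
  shows "product_intersection_set S mult {q} A = {1..}"
  using assms product_set_subset
  by (auto simp: product_intersection_set_def Inter_within_singleton)

section \<open>Degenerate examples\<close>

text \<open>In a left zero semigroup every set equals all of its powers.\<close>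

lemma all_in_product_intersection_sets:
  "{1..} \<in> product_intersection_sets TYPE('s) Q"
proof -
  let ?m = "\<lambda>x y. x :: 's"
  have "product_set ?m B h = B" if "1 \<le> h" for B h
    using that
  proof (induction h rule: dec_induct)
    case (step n)
    then show ?case by (auto simp: product_set_Suc)
  qed simp
  then have "product_intersection_set UNIV ?m Q (\<lambda>_. UNIV) = {1..}"
    by (auto simp: product_intersection_set_def)
  moreover have "semigroup_on UNIV ?m" by unfold_locales auto
  ultimately show ?thesis unfolding product_intersection_sets_def by blast
qed

text \<open>In a null semigroup with at least two elements, every \<open>S\<^sup>h\<close> with \<open>h \<ge> 2\<close> is \<open>{0}\<close>.\<close>

lemma one_in_product_intersection_sets:
  assumes "infinite (UNIV :: 's set)"
  shows "{1} \<in> product_intersection_sets TYPE('s) {}"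
proof -
  obtain a :: 's where True by blast
  let ?m = "\<lambda>x y. a"
  interpret semigroup_on UNIV ?m by unfold_locales auto
  have "UNIV \<noteq> {a}" using assms by (metis finite.emptyI finite.insertI)
  moreover have "product_set ?m UNIV 2 = {a}"
    using product_set_Suc[of 1 ?m UNIV] by (auto simp: numeral_2_eq_2)
  ultimately have "2 \<notin> product_intersection_set UNIV ?m {} (\<lambda>_. UNIV)"
    by (auto simp: product_intersection_set_def Inter_within_def)
  moreover have "(2::nat) \<in> {1..}" by simp
  ultimately have "product_intersection_set UNIV ?m {} (\<lambda>_. UNIV) = {1}"
    using product_intersection_set_empty[of "\<lambda>_. UNIV"] by (metis insertE singletonD)
  then show ?thesis
    unfolding product_intersection_sets_def using semigroup_on_axioms by blast
qed

section \<open>Isomorphic copies\<close>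

lemma product_set_image:
  assumes "inj f" "1 \<le> h"
  shows "product_set (\<lambda>x y. f (mult (inv f x) (inv f y))) (f ` B) h = f ` product_set mult B h"
  using assms(2)
proof (induction h rule: dec_induct)
  case (step n)
  let ?m = "\<lambda>x y. f (mult (inv f x) (inv f y))" and ?P = "product_set mult B n"
  have "{?m x y | x y. x \<in> f ` ?P \<and> y \<in> f ` B}
      = {?m (f x) (f y) | x y. x \<in> ?P \<and> y \<in> B}" by blast
  also have "\<dots> = f ` {mult x y | x y. x \<in> ?P \<and> y \<in> B}"
    unfolding inv_f_f[OF assms(1)] by blast
  finally show ?case using step by (simp only: product_set_Suc)
qed simp

lemma Inter_within_image:
  assumes "inj f"
  shows "Inter_within (f ` S) Q (\<lambda>q. f ` A q) = f ` Inter_within S Q A"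
  using assms by (auto simp: Inter_within_def inj_image_mem_iff)

lemma product_intersection_set_image:
  fixes f :: "'t \<Rightarrow> 's" and S :: "'t set"
  assumes "inj f" "semigroup_on S mult" "\<And>q. q \<in> Q \<Longrightarrow> A q \<subseteq> S"
  shows "product_intersection_set S mult Q A \<in> product_intersection_sets TYPE('s) Q"
proof -
  let ?m = "\<lambda>x y. f (mult (inv f x) (inv f y))"
  interpret semigroup_on S mult by fact
  have "semigroup_on (f ` S) ?m"
    using nonempty by unfold_locales (auto simp: assms(1) closed assoc)
  moreover have "product_intersection_set (f ` S) ?m Q (\<lambda>q. f ` A q)
      = product_intersection_set S mult Q A"
    unfolding product_intersection_set_def
    by (intro Collect_cong conj_cong refl)
      (simp add: product_set_image assms(1) Inter_within_image inj_image_eq_iff)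
  moreover have "\<forall>q\<in>Q. f ` A q \<subseteq> f ` S" using assms(3) by blast
  ultimately show ?thesis unfolding product_intersection_sets_def by blast
qed

section \<open>A semigroup with prescribed coincidences of powers\<close>

text \<open>
  \<open>Pow True n i\<close> stands for \<open>a\<^sub>n\<^sup>i\<close> and \<open>Pow False n i\<close> for \<open>b\<^sub>n\<^sup>i\<close>, where \<open>1 \<le> i \<le> n\<close>. The
  common value \<open>a\<^sub>n\<^sup>n = b\<^sub>n\<^sup>n\<close> is represented by \<open>Pow True n n\<close> only.
\<close>

datatype power = Zero | Pow bool nat nat

instance power :: countable by countable_datatype

definition powers :: "power set" where
  "powers = insert Zero {Pow s n i | s n i. 1 \<le> i \<and> i \<le> n \<and> (i = n \<longrightarrow> s)}"

text \<open>
  The top power \<open>Pow True n n\<close> annihilates every element of \<open>powers\<close>: exponents there are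
  positive, so the sum of the exponents exceeds \<open>n\<close>.
\<close>

fun pmult :: "power \<Rightarrow> power \<Rightarrow> power" where
  "pmult (Pow s m i) (Pow t n j) =
     (if s = t \<and> m = n \<and> i + j \<le> n then Pow (s \<or> i + j = n) n (i + j) else Zero)"
| "pmult _ _ = Zero"

lemma pmult_Zero_right: "pmult x Zero = Zero"
  by (cases x) auto

lemma semigroup_on_powers: "semigroup_on powers pmult"
proof
  show "powers \<noteq> {}" by (auto simp: powers_def)
  show "pmult x y \<in> powers" if "x \<in> powers" "y \<in> powers" for x y
    using that by (cases x; cases y) (auto simp: powers_def)
  show "pmult (pmult x y) z = pmult x (pmult y z)"
    if xyz: "x \<in> powers" "y \<in> powers" "z \<in> powers" for x y z
  proof (cases "x = Zero \<or> y = Zero \<or> z = Zero")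
    case True
    then show ?thesis by (auto simp: pmult_Zero_right)
  next
    case False
    then obtain s l i t m j u n k
      where eq: "x = Pow s l i" "y = Pow t m j" "z = Pow u n k"
        and pos: "1 \<le> i" "1 \<le> j" "1 \<le> k"
      using xyz unfolding powers_def by blast
    \<comment> \<open>Both bracketings are \<open>0\<close> if an intermediate product is a top power: a further factor makes it too long.\<close>
    let ?r = "if s = t \<and> t = u \<and> l = m \<and> m = n \<and> i + j + k \<le> n
      then Pow (s \<or> i + j + k = n) n (i + j + k) else Zero"
    have "pmult (pmult x y) z = ?r"
      unfolding eq using pos by (cases s; cases t; cases u) simp_all
    also have "?r = pmult x (pmult y z)"
      unfolding eq using pos by (cases s; cases t; cases u) (simp_all add: add.assoc)
    finally show ?thesis .
  qed
qed

definition generators :: "bool \<Rightarrow> nat set \<Rightarrow> power set" where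
  "generators s N = insert Zero {Pow s n 1 | n. n \<in> N}"

lemma generators_subset_powers: "N \<subseteq> {2..} \<Longrightarrow> generators s N \<subseteq> powers"
  by (force simp: generators_def powers_def)

text \<open>
  Only powers of a single generator survive. At exponent \<open>1\<close> the formula for the flag is
  correct because \<open>1 \<notin> N\<close>.
\<close>

lemma product_set_generators:
  assumes "N \<subseteq> {2..}" "1 \<le> k"
  shows "product_set pmult (generators s N) k
           = insert Zero {Pow (s \<or> n = k) n k | n. n \<in> N \<and> k \<le> n}"
  using assms(2)
proof (induction k rule: dec_induct)
  case base
  then show ?case using assms(1) by (fastforce simp: generators_def)
next
  case (step k)
  show ?case (is "_ = ?R")
  proof
    show "product_set pmult (generators s N) (Suc k) \<subseteq> ?R"
    proof
      fix z assume "z \<in> product_set pmult (generators s N) (Suc k)"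
      then obtain x y where z: "z = pmult x y" and y: "y \<in> generators s N"
        and x: "x \<in> insert Zero {Pow (s \<or> n = k) n k | n. n \<in> N \<and> k \<le> n}"
        unfolding product_set_Suc[OF step(1)] step.IH by blast
      show "z \<in> ?R"
      proof (cases "x = Zero \<or> y = Zero")
        case True
        then show ?thesis using z by (auto simp: pmult_Zero_right)
      next
        case False
        then obtain m n where "x = Pow (s \<or> m = k) m k" "y = Pow s n 1" "n \<in> N"
          using x y by (auto simp: generators_def)
        then show ?thesis using z by (cases "m = n \<and> k < n") auto
      qed
    qed
    show "?R \<subseteq> product_set pmult (generators s N) (Suc k)"
    proof
      fix z assume "z \<in> ?R"
      then consider "z = Zero"
        | n where "n \<in> N" "Suc k \<le> n" "z = Pow (s \<or> n = Suc k) n (Suc k)"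
        by blast
      then show "z \<in> product_set pmult (generators s N) (Suc k)"
      proof cases
        case 1
        then have "z = pmult Zero Zero" "Zero \<in> generators s N"
          by (simp_all add: generators_def)
        then show ?thesis
          unfolding product_set_Suc[OF step(1)] step.IH by blast
      next
        case 2
        then have "z = pmult (Pow (s \<or> n = k) n k) (Pow s n 1)" "k \<le> n" by auto
        moreover have "Pow s n 1 \<in> generators s N" using 2 by (auto simp: generators_def)
        ultimately show ?thesis
          unfolding product_set_Suc[OF step(1)] step.IH using 2(1) by blast
      qed
    qed
  qed
qed

lemma Inter_within_two:
  assumes "q0 \<in> Q" "q1 \<in> Q" "q0 \<noteq> q1" "F \<subseteq> S"
  shows "Inter_within S Q (\<lambda>q. if q = q0 then F else T) = F \<inter> T"
  using assms by (auto simp: Inter_within_def)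

lemma product_intersection_set_generators:
  assumes "q0 \<in> Q" "q1 \<in> Q" "q0 \<noteq> q1" "N \<subseteq> {2..}"
  shows "product_intersection_set powers pmult Q (\<lambda>q. generators (q \<noteq> q0) N) = {1..} - N"
proof -
  interpret semigroup_on powers pmult by (rule semigroup_on_powers)
  note sub = generators_subset_powers[OF assms(4)]
  \<comment> \<open>The intersection of the family is \<open>{0}\<close>, the set of generators for the empty index set.\<close>
  have base: "Inter_within powers Q (\<lambda>q. generators (q \<noteq> q0) N) = generators True {}"
  proof -
    have "(\<lambda>q. generators (q \<noteq> q0) N)
        = (\<lambda>q. if q = q0 then generators False N else generators True N)" by (rule ext) simp
    then show ?thesis
      using Inter_within_two[OF assms(1-3) sub] by (auto simp: generators_def)
  qed
  have "product_set pmult (Inter_within powers Q (\<lambda>q. generators (q \<noteq> q0) N)) h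
      = Inter_within powers Q (\<lambda>q. product_set pmult (generators (q \<noteq> q0) N) h) \<longleftrightarrow> h \<notin> N"
    if h: "1 \<le> h" for h
  proof -
    have "(\<lambda>q. product_set pmult (generators (q \<noteq> q0) N) h)
        = (\<lambda>q. if q = q0 then product_set pmult (generators False N) h
                else product_set pmult (generators True N) h)" by (rule ext) simp
    then have "Inter_within powers Q (\<lambda>q. product_set pmult (generators (q \<noteq> q0) N) h)
        = product_set pmult (generators False N) h \<inter> product_set pmult (generators True N) h"
      using Inter_within_two[OF assms(1-3) product_set_subset[OF h sub]] by simp
    also have "\<dots> = insert Zero {Pow True n h | n. n = h \<and> n \<in> N}"
      unfolding product_set_generators[OF assms(4) h] by auto
    finally show ?thesis
      unfolding base using h by (auto simp: product_set_generators)
  qed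
  then show ?thesis by (auto simp: product_intersection_set_def)
qed

lemma every_set_in_product_intersection_sets:
  assumes "infinite (UNIV :: 's set)" "q0 \<in> Q" "q1 \<in> Q" "q0 \<noteq> q1" "X \<subseteq> {1..}" "1 \<in> X"
  shows "X \<in> product_intersection_sets TYPE('s) Q"
proof -
  obtain g :: "nat \<Rightarrow> 's" where "inj g"
    using infinite_countable_subset[OF assms(1)] by blast
  then have inj: "inj (g \<circ> to_nat :: power \<Rightarrow> 's)" by (intro inj_compose) auto
  define N where "N = {1..} - X"
  have "n \<noteq> 1" if "n \<in> N" for n using that assms(6) by (auto simp: N_def)
  then have N: "N \<subseteq> {2..}" by (force simp: N_def)
  have "product_intersection_set powers pmult Q (\<lambda>q. generators (q \<noteq> q0) N)
      \<in> product_intersection_sets TYPE('s) Q"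
    by (intro product_intersection_set_image[OF inj semigroup_on_powers]
        generators_subset_powers N)
  moreover have "{1..} - N = X" using assms(5) by (auto simp: N_def)
  ultimately show ?thesis
    using product_intersection_set_generators[OF assms(2-4) N] by simp
qed

section \<open>The classification\<close>

theorem theorem1p2:
  fixes Q :: "'q set"
  assumes "infinite (UNIV :: 's set)"
  shows "(Q = {} \<longrightarrow> product_intersection_sets TYPE('s) Q = {{1}, {1..}}) \<and>
         (card Q = 1 \<longrightarrow> product_intersection_sets TYPE('s) Q = {{1..}}) \<and>
         (infinite Q \<or> card Q \<ge> 2 \<longrightarrow>
            product_intersection_sets TYPE('s) Q = {X. X \<subseteq> {1..} \<and> 1 \<in> X})"
proof (intro conjI impI)
  assume Q: "Q = {}"
  show "product_intersection_sets TYPE('s) Q = {{1}, {1..}}"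
  proof
    show "product_intersection_sets TYPE('s) Q \<subseteq> {{1}, {1..}}"
      using semigroup_on.product_intersection_set_empty
      unfolding Q product_intersection_sets_def by blast
    show "{{1}, {1..}} \<subseteq> product_intersection_sets TYPE('s) Q"
      unfolding Q
      using one_in_product_intersection_sets[OF assms] all_in_product_intersection_sets by blast
  qed
next
  assume "card Q = 1"
  then obtain q where Q: "Q = {q}" by (auto simp: card_1_singleton_iff)
  have "X = {1..}" if "X \<in> product_intersection_sets TYPE('s) Q" for X
  proof -
    obtain S :: "'s set" and mult and A :: "'q \<Rightarrow> 's set"
      where "X = product_intersection_set S mult {q} A" "semigroup_on S mult" "A q \<subseteq> S"
      using \<open>X \<in> _\<close> unfolding Q product_intersection_sets_def by blast
    then show ?thesis by (simp only: semigroup_on.product_intersection_set_singleton)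
  qed
  then show "product_intersection_sets TYPE('s) Q = {{1..}}"
    using all_in_product_intersection_sets by blast
next
  assume "infinite Q \<or> card Q \<ge> 2"
  then have "\<not> is_singleton Q" "Q \<noteq> {}"
    by (auto simp: is_singleton_def)
  then obtain q0 q1 where q: "q0 \<in> Q" "q1 \<in> Q" "q0 \<noteq> q1"
    using is_singletonI'[of Q] by blast
  show "product_intersection_sets TYPE('s) Q = {X. X \<subseteq> {1..} \<and> 1 \<in> X}"
  proof (intro set_eqI iffI)
    fix X assume "X \<in> product_intersection_sets TYPE('s) Q"
    then show "X \<in> {X. X \<subseteq> {1..} \<and> 1 \<in> X}"
      by (intro CollectI conjI product_intersection_sets_basic)
  next
    fix X :: "nat set" assume "X \<in> {X. X \<subseteq> {1..} \<and> 1 \<in> X}"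
    then show "X \<in> product_intersection_sets TYPE('s) Q"
      using every_set_in_product_intersection_sets[OF assms q] by simp
  qed
qed

end
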